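(* Let $k\ge n\ge 3$ be integers. The set $Z_n(k)$ of all positive integers having the summand $F_{n,k}$ in their $n$-decomposition is given by $$Z_n(k)=\left\{\,j+F_{n,k}+\sum_{i=1}^n F_{n,k+i}\cdot N_{a_i}(m)\;:\;0\le j\le F_{n,k-(n-1)}-1 \text{ and } m\ge 0\right\},$$ where $j$ and $m$ range over integers.
   Context: For an integer $n\ge 2$, define $F_{n,1}=F_{n,2}=\cdots=F_{n,n}=1$ and $F_{n,m+1}=F_{n,m}+F_{n,m+1-n}$ for all $m\ge n$. The $n$-decomposition of a positive integer $m$ is its (known to exist and be unique) representation $m=\sum_{i=1}^r F_{n,c_i}$ with $r\ge 1$, $c_1\ge n$ and $c_i\ge c_{i-1}+n$ for $2\le i\le r$. It has the summand $F_{n,k}$ if $c_i=k$ for some $i$. Let $a_1,\dots,a_n$ be distinct letters and let $\circ$ denote concatenation of strings. Define $S_1=a_1,\dots,S_n=a_n$ (one-letter strings) and $S_m=S_{m-1}\circ S_{m-n}$ for $m\ge n+1$. For $m\ge n$, $S_m$ is a prefix of $S_{m+1}$, and $S_\infty$ (the $n$-string) is the infinite string having every $S_m$, $m\ge n$, as a prefix. For $m\ge 0$ and $1\le i\le n$, $N_{a_i}(m)$ denotes the number of occurrences of the letter $a_i$ among the first $m$ letters of $S_\infty$; in particular $N_{a_i}(0)=0$. *)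

theory Defs
  imports "HOL-Library.Stream" "HOL-Library.Sublist"
begin

text \<open>The index \<open>m\<close> starts at 1; the values at \<open>m = 0\<close> or \<open>n = 0\<close> are irrelevant.\<close>

function F :: "nat \<Rightarrow> nat \<Rightarrow> nat" where
  "F n m = (if 1 \<le> n \<and> n < m then F n (m - 1) + F n (m - n) else 1)"
  by auto
termination by (relation "measure snd") auto

declare F.simps [simp del]

text \<open>The list \<open>c\<close> holds \<open>c\<^sub>1, \<dots>, c\<^sub>r\<close>, in increasing order.\<close>

definition is_decomposition :: "nat \<Rightarrow> nat \<Rightarrow> nat list \<Rightarrow> bool" where
  "is_decomposition n m c \<longleftrightarrow>
     c \<noteq> [] \<and> n \<le> hd c \<and> successively (\<lambda>x y. x + n \<le> y) c \<and> m = (\<Sum>i\<leftarrow>c. F n i)"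

definition decomposition :: "nat \<Rightarrow> nat \<Rightarrow> nat list" where
  "decomposition n m = (THE c. is_decomposition n m c)"

definition has_summand :: "nat \<Rightarrow> nat \<Rightarrow> nat \<Rightarrow> bool" where
  "has_summand n m k \<longleftrightarrow> k \<in> set (decomposition n m)"

definition Z :: "nat \<Rightarrow> nat \<Rightarrow> nat set" where
  "Z n k = {m. 1 \<le> m \<and> has_summand n m k}"

text \<open>The letters \<open>a\<^sub>1, \<dots>, a\<^sub>n\<close> are \<open>a 1, \<dots>, a n\<close>; \<open>a\<close> should be injective on \<open>{1..n}\<close>.\<close>

function S :: "(nat \<Rightarrow> 'a) \<Rightarrow> nat \<Rightarrow> nat \<Rightarrow> 'a list" where
  "S a n m = (if 1 \<le> n \<and> n < m then S a n (m - 1) @ S a n (m - n) else [a m])"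
  by auto
termination by (relation "measure (\<lambda>(_, _, m). m)") auto

declare S.simps [simp del]

definition S_inf :: "(nat \<Rightarrow> 'a) \<Rightarrow> nat \<Rightarrow> 'a stream" where
  "S_inf a n = (THE w. \<forall>m\<ge>n. stake (length (S a n m)) w = S a n m)"

definition N :: "(nat \<Rightarrow> 'a) \<Rightarrow> nat \<Rightarrow> 'a \<Rightarrow> nat \<Rightarrow> nat" where
  "N a n x m = count_list (stake m (S_inf a n)) x"

subsection \<open>The definite descriptions above are well defined\<close>

lemma F_init: "m \<le> n \<Longrightarrow> F n m = 1"
  by (subst F.simps) simp

lemma F_rec: "1 \<le> n \<Longrightarrow> n \<le> m \<Longrightarrow> F n (m + 1) = F n m + F n (m + 1 - n)"
  by (subst F.simps) simp

lemma F_pos: "0 < F n m"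
proof (induction m rule: less_induct)
  case (less m)
  then show ?case by (subst F.simps) auto
qed

lemma F_mono_Suc: "F n m \<le> F n (Suc m)"
  using F_pos[of n m] by (subst (2) F.simps) (auto simp: F.simps[of n m])

lemma F_mono: "i \<le> j \<Longrightarrow> F n i \<le> F n j"
  by (rule lift_Suc_mono_le[of "F n"]) (auto intro: F_mono_Suc)

lemma F_unbounded: "1 \<le> n \<Longrightarrow> d < F n (n + d)"
proof (induction d)
  case (Suc d)
  then show ?case
    using F_rec[of n "n + d"] F_pos[of n "n + d + 1 - n"] by simp
qed (simp add: F_pos)

lemma is_decomposition_snoc:
  "is_decomposition n m (c @ [x]) \<longleftrightarrow>
     (if c = [] then n \<le> x \<and> m = F n x
      else \<exists>m'. is_decomposition n m' c \<and> last c + n \<le> x \<and> m = m' + F n x)"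
  by (auto simp: is_decomposition_def successively_append_iff)

lemma is_decomposition_last:
  assumes "1 \<le> n" and "is_decomposition n m c"
  shows "n \<le> last c \<and> F n (last c) \<le> m \<and> m < F n (last c + 1)"
  using assms(2)
proof (induction c arbitrary: m rule: rev_induct)
  case (snoc x c)
  show ?case
  proof (cases "c = []")
    case True
    then show ?thesis
      using snoc.prems F_rec[OF assms(1), of x] F_pos[of n "x + 1 - n"]
      by (auto simp: is_decomposition_def)
  next
    case False
    then obtain m' where m': "is_decomposition n m' c" "last c + n \<le> x" "m = m' + F n x"
      using snoc.prems by (auto simp: is_decomposition_snoc)
    have "m' < F n (last c + 1)"
      using snoc.IH[OF m'(1)] by simp
    also have "\<dots> \<le> F n (x + 1 - n)"
      using m'(2) by (intro F_mono) simp
    finally show ?thesis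
      using m' F_rec[OF assms(1), of x] by simp
  qed
qed (simp add: is_decomposition_def)

lemma is_decomposition_unique:
  assumes "1 \<le> n" and "is_decomposition n m c" and "is_decomposition n m d"
  shows "c = d"
  using assms(2,3)
proof (induction c arbitrary: m d rule: rev_induct)
  case (snoc x c)
  obtain y d' where d: "d = d' @ [y]"
    using snoc.prems(2) by (metis is_decomposition_def rev_exhaust)
  have bx: "F n x \<le> m" "m < F n (x + 1)"
    using is_decomposition_last[OF assms(1) snoc.prems(1)] by auto
  have bd: "F n y \<le> m" "m < F n (y + 1)"
    using is_decomposition_last[OF assms(1) snoc.prems(2)] d by auto
  have "\<not> x < y" "\<not> y < x"
    using bx bd F_mono[of "x + 1" y n] F_mono[of "y + 1" x n] by auto
  then have xy: "x = y" by simp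
  have pos: "0 < m'" if "is_decomposition n m' e" for m' e
    using is_decomposition_last[OF assms(1) that] F_pos[of n "last e"] by linarith
  have "c = d'"
    using snoc.prems snoc.IH pos unfolding d xy is_decomposition_snoc
    by (auto split: if_splits)
  then show ?case using d xy by simp
qed (simp add: is_decomposition_def)

lemma is_decomposition_exists:
  assumes "1 \<le> n" and "1 \<le> m"
  shows "\<exists>c. is_decomposition n m c"
  using assms(2)
proof (induction m rule: less_induct)
  case (less m)
  define P where "P x \<longleftrightarrow> n \<le> x \<and> F n x \<le> m" for x
  have "P n" using less.prems by (simp add: P_def F_init)
  moreover have bound: "x \<le> n + m" if "P x" for x
    using that F_unbounded[OF assms(1), of m] F_mono[of "n + m" x n]
    by (force simp: P_def)
  ultimately have x: "P (Greatest P)" and "\<not> P (Greatest P + 1)"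
    using GreatestI_nat[of P n "n + m"] Greatest_le_nat[of P "Greatest P + 1" "n + m"]
    by force+
  moreover define x where "x = Greatest P"
  ultimately have x: "n \<le> x" "F n x \<le> m" "m < F n (x + 1)"
    by (auto simp: P_def)
  show ?case
  proof (cases "m = F n x")
    case True
    then have "is_decomposition n m ([] @ [x])"
      using x unfolding is_decomposition_snoc by simp
    then show ?thesis by blast
  next
    case False
    with x less.IH[of "m - F n x"] F_pos[of n x] obtain c
      where c: "is_decomposition n (m - F n x) c" by force
    have "F n (last c) < F n (x + 1 - n)"
      using is_decomposition_last[OF assms(1) c] x F_rec[OF assms(1), of x] by linarith
    then have "last c + n \<le> x"
      using F_mono[of "x + 1 - n" "last c" n] x(1) by fastforce
    then have "is_decomposition n m (c @ [x])"
      using c x unfolding is_decomposition_snoc by (auto simp: is_decomposition_def)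
    then show ?thesis by blast
  qed
qed

lemma decomposition_eq_iff:
  assumes "1 \<le> n" and "1 \<le> m"
  shows "decomposition n m = c \<longleftrightarrow> is_decomposition n m c"
  unfolding decomposition_def
  using assms is_decomposition_exists is_decomposition_unique by (metis the_equality)

lemma length_S: "length (S a n m) = F n m"
proof (induction m rule: less_induct)
  case (less m)
  then show ?case by (subst S.simps, subst F.simps) auto
qed

lemma S_prefix:
  assumes "1 \<le> n" and "n \<le> i" and "i \<le> j"
  shows "prefix (S a n i) (S a n j)"
  using assms(3)
proof (induction j rule: dec_induct)
  case (step j)
  have "S a n (Suc j) = S a n j @ S a n (Suc j - n)"
    using assms step by (subst S.simps) simp
  then show ?case using step.IH by (simp add: prefix_prefix)
qed simp

lemma S_inf_ex1:
  assumes "1 \<le> n"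
  shows "\<exists>!w. \<forall>m\<ge>n. stake (length (S a n m)) w = S a n m"
proof (rule ex_ex1I)
  let ?w = "smap (\<lambda>i. S a n (n + i) ! i) nats"
  have "stake (length (S a n m)) ?w = S a n m" if "n \<le> m" for m
  proof (rule nth_equalityI)
    fix i assume "i < length (stake (length (S a n m)) ?w)"
    then have i: "i < length (S a n m)" by simp
    have i': "i < length (S a n (n + i))"
      using F_unbounded[OF assms, of i] by (simp add: length_S)
    have "prefix (S a n m) (S a n (n + i)) \<or> prefix (S a n (n + i)) (S a n m)"
      using S_prefix[OF assms, of m "n + i" a] S_prefix[OF assms, of "n + i" m a] that
      by (meson le_add1 nat_le_linear)
    then have "S a n (n + i) ! i = S a n m ! i"
      using i i' by (auto simp: prefix_def nth_append)
    then show "stake (length (S a n m)) ?w ! i = S a n m ! i"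
      using i by (simp del: stake_smap)
  qed simp
  then show "\<exists>w. \<forall>m\<ge>n. stake (length (S a n m)) w = S a n m" by blast
next
  fix v w :: "'a stream"
  assume v: "\<forall>m\<ge>n. stake (length (S a n m)) v = S a n m"
    and w: "\<forall>m\<ge>n. stake (length (S a n m)) w = S a n m"
  have "v !! i = w !! i" for i
  proof -
    have "i < length (S a n (n + i))"
      using F_unbounded[OF assms, of i] by (simp add: length_S)
    then show ?thesis using v w by (metis le_add1 stake_nth)
  qed
  then show "v = w" by (metis stream_smap_nats ext)
qed

lemma stake_S_inf:
  assumes "1 \<le> n" and "n \<le> m"
  shows "stake (length (S a n m)) (S_inf a n) = S a n m"
  using theI'[OF S_inf_ex1[OF assms(1), of a]] assms(2) unfolding S_inf_def by blast

end

theory Submission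
  imports Defs
begin

text \<open>
  Cut the decomposition of a number at its summand \<open>F n k\<close>. The indices below \<open>k\<close> are at most
  \<open>k - n\<close>, and the sums of such, possibly empty, decompositions are exactly the numbers below \<open>F n (k - n + 1)\<close>
  (\<open>sparse_snoc_iff\<close>); they are the \<open>j\<close> of the theorem. The indices above \<open>k\<close> are \<open>k + d\<close> with
  \<open>d\<close> running over the decomposition of an arbitrary number \<open>m\<close>, because the gap condition is
  invariant under translation (\<open>sparse_shift\<close>). So it remains to express the sum of the
  \<open>F n (k + d)\<close> in terms of \<open>m\<close>.

  This is what the \<open>n\<close>-string does. Give the letter \<open>a i\<close> the weight \<open>F n (k + i)\<close>. Since the
  strings \<open>S a n d\<close> and the numbers \<open>F n (k + d)\<close> obey the same recursion, \<open>S a n d\<close> has weight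
  \<open>F n (k + d)\<close> (\<open>weight_S\<close>). The prefix of length \<open>m\<close> of the \<open>n\<close>-string is the
  concatenation of the strings \<open>S a n d\<close>, with \<open>d\<close> running over the decomposition of \<open>m\<close> from
  the largest index down (\<open>stake_S_inf_add\<close>). Hence its weight, which is the sum in the theorem,
  is the sum of the \<open>F n (k + d)\<close> (\<open>weight_stake_S_inf\<close>).
\<close>

text \<open>
  The leading \<open>0\<close> forces the first index to be at least \<open>n\<close>. Unlike decompositions, sparse lists
  may be empty, so that \<open>0\<close> is represented too.
\<close>

definition sparse :: "nat \<Rightarrow> nat list \<Rightarrow> bool" where
  "sparse n c \<longleftrightarrow> successively (\<lambda>x y. x + n \<le> y) (0 # c)"

lemma is_decomposition_iff_sparse:
  "is_decomposition n m c \<longleftrightarrow> c \<noteq> [] \<and> sparse n c \<and> m = (\<Sum>i\<leftarrow>c. F n i)"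
  by (cases c) (auto simp: is_decomposition_def sparse_def)

lemma sparse_exists:
  assumes "1 \<le> n"
  shows "\<exists>c. sparse n c \<and> (\<Sum>i\<leftarrow>c. F n i) = m"
proof (cases "m = 0")
  case True
  then show ?thesis by (intro exI[of _ "[]"]) (simp add: sparse_def)
next
  case False
  then show ?thesis
    using is_decomposition_exists[OF assms, of m] by (auto simp: is_decomposition_iff_sparse)
qed

lemma Z_iff_sparse:
  assumes "1 \<le> n"
  shows "t \<in> Z n k \<longleftrightarrow> (\<exists>c. sparse n c \<and> k \<in> set c \<and> t = (\<Sum>i\<leftarrow>c. F n i))"
proof
  assume "t \<in> Z n k"
  then have "1 \<le> t" "k \<in> set (decomposition n t)"
    by (auto simp: Z_def has_summand_def)
  moreover from this(1) have "is_decomposition n t (decomposition n t)"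
    using decomposition_eq_iff[OF assms] by blast
  ultimately show "\<exists>c. sparse n c \<and> k \<in> set c \<and> t = (\<Sum>i\<leftarrow>c. F n i)"
    by (auto simp: is_decomposition_iff_sparse)
next
  assume "\<exists>c. sparse n c \<and> k \<in> set c \<and> t = (\<Sum>i\<leftarrow>c. F n i)"
  then obtain c where "sparse n c" "k \<in> set c" "t = (\<Sum>i\<leftarrow>c. F n i)" by blast
  then have c: "is_decomposition n t c" "k \<in> set c"
    by (auto simp: is_decomposition_iff_sparse)
  have "1 \<le> t"
    using is_decomposition_last[OF assms c(1)] F_pos[of n "last c"] by linarith
  then show "t \<in> Z n k"
    using c decomposition_eq_iff[OF assms, of t c] by (simp add: Z_def has_summand_def)
qed

lemma sparse_split:
  "sparse n (c @ k # d) \<longleftrightarrow> sparse n (c @ [k]) \<and> successively (\<lambda>x y. x + n \<le> y) (k # d)"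
  unfolding sparse_def append_Cons[symmetric] successively_append_iff by auto

text \<open>
  A sparse list can be extended by \<open>k\<close> iff its last index is at most \<open>k - n\<close>. As its sum lies
  between \<open>F n\<close> of the last index and \<open>F n\<close> of the next one, monotonicity turns this condition
  on the list into a condition on the sum alone.
\<close>

lemma sparse_snoc_iff:
  assumes "1 \<le> n" and "n \<le> k"
  shows "sparse n (c @ [k]) \<longleftrightarrow> sparse n c \<and> (\<Sum>i\<leftarrow>c. F n i) < F n (k - (n - 1))"
proof (cases "c = []")
  case True
  then show ?thesis using assms by (simp add: sparse_def F_pos)
next
  case False
  have "last c + n \<le> k \<longleftrightarrow> (\<Sum>i\<leftarrow>c. F n i) < F n (k - (n - 1))" if "sparse n c"
  proof -
    have b: "F n (last c) \<le> (\<Sum>i\<leftarrow>c. F n i)" "(\<Sum>i\<leftarrow>c. F n i) < F n (last c + 1)"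
      using is_decomposition_last[OF assms(1)] that False
      by (auto simp: is_decomposition_iff_sparse)
    show ?thesis
    proof (cases "last c + n \<le> k")
      case True
      then have "F n (last c + 1) \<le> F n (k - (n - 1))"
        using assms by (intro F_mono) linarith
      with b True show ?thesis by simp
    next
      case False
      then have "F n (k - (n - 1)) \<le> F n (last c)"
        using assms by (intro F_mono) linarith
      with b False show ?thesis by simp
    qed
  qed
  then show ?thesis
    using False unfolding sparse_def append_Cons[symmetric] successively_append_iff by auto
qed

lemma sparse_shift:
  "successively (\<lambda>x y. x + n \<le> y) (k # d) \<longleftrightarrow> (\<exists>e. sparse n e \<and> d = map ((+) k) e)"
proof
  assume *: "successively (\<lambda>x y. x + n \<le> y) (k # d)"
  then have "sorted_wrt (\<lambda>x y. x + n \<le> y) (k # d)"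
    by (subst successively_conv_sorted_wrt[symmetric]) (auto intro: transpI)
  then have "\<forall>x\<in>set d. k \<le> x" by auto
  then have d: "map ((+) k) (map (\<lambda>x. x - k) d) = d"
    by (auto simp: o_def intro!: map_idI)
  then have "successively (\<lambda>x y. x + n \<le> y) (map ((+) k) (0 # map (\<lambda>x. x - k) d))"
    using * by (simp del: map_map)
  then have "sparse n (map (\<lambda>x. x - k) d)"
    unfolding sparse_def successively_map by simp
  with d show "\<exists>e. sparse n e \<and> d = map ((+) k) e" by metis
next
  assume "\<exists>e. sparse n e \<and> d = map ((+) k) e"
  then obtain e where e: "sparse n e" "d = map ((+) k) e" by blast
  then have "successively (\<lambda>x y. x + n \<le> y) (map ((+) k) (0 # e))"
    unfolding sparse_def successively_map by simp
  then show "successively (\<lambda>x y. x + n \<le> y) (k # d)" using e by simp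
qed

definition weight :: "(nat \<Rightarrow> 'a) \<Rightarrow> nat \<Rightarrow> nat \<Rightarrow> 'a list \<Rightarrow> nat" where
  "weight a n k w = (\<Sum>i=1..n. F n (k + i) * count_list w (a i))"

lemma weight_append: "weight a n k (v @ w) = weight a n k v + weight a n k w"
  by (simp add: weight_def distrib_left sum.distrib)

text \<open>
  Both sides satisfy the same recursion in \<open>m\<close>; the weights of the letters are chosen such that
  the initial values agree as well.
\<close>

lemma weight_S:
  assumes "1 \<le> n" and "inj_on a {1..n}" and "1 \<le> m"
  shows "weight a n k (S a n m) = F n (k + m)"
  using assms(3)
proof (induction m rule: less_induct)
  case (less m)
  show ?case
  proof (cases "1 \<le> n \<and> n < m")
    case True
    then have "S a n m = S a n (m - 1) @ S a n (m - n)"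
      by (subst S.simps) simp
    moreover have "F n (k + m) = F n (k + (m - 1)) + F n (k + (m - n))"
      using True by (subst F.simps) simp
    ultimately show ?thesis
      using True less.IH[of "m - 1"] less.IH[of "m - n"] by (simp add: weight_append Suc_le_eq)
  next
    case False
    then have S: "S a n m = [a m]" by (subst S.simps) auto
    have "weight a n k (S a n m) = (\<Sum>i=1..n. if i = m then F n (k + i) else 0)"
      unfolding weight_def S
      using assms(1,2) False less.prems by (intro sum.cong) (auto dest: inj_onD)
    then show ?thesis using assms(1) False less.prems by simp
  qed
qed

text \<open>
  The \<open>n\<close>-string starts with \<open>S a n (x + 1) = S a n x @ S a n (x + 1 - n)\<close>, and within the
  second factor it starts over, since that factor is itself a prefix of the \<open>n\<close>-string
  unless it is a single letter.
\<close>

lemma stake_S_inf_add: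
  assumes "1 \<le> n" and "n \<le> x" and "m < F n (x + 1 - n)"
  shows "stake (F n x + m) (S_inf a n) = S a n x @ stake m (S_inf a n)"
proof -
  have len: "F n (x + 1) = F n x + F n (x + 1 - n)"
    using F_rec[OF assms(1,2)] .
  have S: "S a n (x + 1) = S a n x @ S a n (x + 1 - n)"
    using assms by (subst S.simps) simp
  have tail: "take m (S a n (x + 1 - n)) = stake m (S_inf a n)"
  proof (cases "n \<le> x + 1 - n")
    case True
    then show ?thesis
      using stake_S_inf[OF assms(1) True, of a] assms(3)
      by (metis length_S less_imp_le min_absorb1 take_stake)
  next
    \<comment> \<open>Here the second factor is the single letter \<open>a (x + 1 - n)\<close>, while the
      \<open>n\<close>-string starts with \<open>a n\<close>; but then \<open>m = 0\<close>.\<close>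
    case False
    then show ?thesis using assms(3) by (simp add: F_init)
  qed
  have "stake (F n x + m) (S_inf a n) = take (F n x + m) (stake (F n (x + 1)) (S_inf a n))"
    using assms(3) len by (simp add: take_stake min_def)
  also have "\<dots> = take (F n x + m) (S a n (x + 1))"
    using stake_S_inf[of n "x + 1" a] assms by (simp add: length_S)
  also have "\<dots> = S a n x @ stake m (S_inf a n)"
    unfolding S by (simp add: tail[simplified] length_S)
  finally show ?thesis .
qed

lemma weight_stake_S_inf:
  assumes "1 \<le> n" and "inj_on a {1..n}" and "sparse n c"
  shows "weight a n k (stake (\<Sum>i\<leftarrow>c. F n i) (S_inf a n)) = (\<Sum>i\<leftarrow>c. F n (k + i))"
  using assms(3)
proof (induction c rule: rev_induct)
  case Nil
  then show ?case by (simp add: weight_def)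
next
  case (snoc x c)
  let ?m = "\<Sum>i\<leftarrow>c. F n i"
  have "n \<le> x"
    using is_decomposition_last[OF assms(1), of _ "c @ [x]"] snoc.prems
    by (simp add: is_decomposition_iff_sparse)
  with snoc.prems have c: "sparse n c" "?m < F n (x + 1 - n)"
    using sparse_snoc_iff[OF assms(1)] assms(1) by auto
  have "stake (F n x + ?m) (S_inf a n) = S a n x @ stake ?m (S_inf a n)"
    using stake_S_inf_add[OF assms(1) \<open>n \<le> x\<close> c(2)] .
  then show ?case
    using snoc.IH[OF c(1)] weight_S[OF assms(1,2), of x k] assms(1) \<open>n \<le> x\<close>
    by (simp add: weight_append add.commute)
qed

theorem theorem1p7:
  fixes n k :: nat and a :: "nat \<Rightarrow> 'a"
  assumes "n \<ge> 3" and "k \<ge> n" and "inj_on a {1..n}"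
  shows "Z n k = {j + F n k + (\<Sum>i=1..n. F n (k + i) * N a n (a i) m) | j m :: nat.
                    0 \<le> j \<and> j \<le> F n (k - (n - 1)) - 1 \<and> m \<ge> 0}"
proof -
  have n: "1 \<le> n" using assms(1) by simp
  let ?sum = "\<lambda>c. \<Sum>i\<leftarrow>c. F n i"
  let ?w = "\<lambda>m. weight a n k (stake m (S_inf a n))"
  have iff: "t \<in> Z n k \<longleftrightarrow> (\<exists>j m. j < F n (k - (n - 1)) \<and> t = j + F n k + ?w m)" for t
  proof -
    have "t \<in> Z n k \<longleftrightarrow> (\<exists>c d. sparse n (c @ k # d) \<and> t = ?sum (c @ k # d))"
      unfolding Z_iff_sparse[OF n] by (metis in_set_conv_decomp)
    also have "\<dots> \<longleftrightarrow> (\<exists>c e. sparse n c \<and> ?sum c < F n (k - (n - 1)) \<and> sparse n e \<and>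
        t = ?sum c + F n k + (\<Sum>i\<leftarrow>e. F n (k + i)))"
      (is "?L \<longleftrightarrow> ?R")
    proof -
      have sum: "?sum (c @ k # map ((+) k) e) = ?sum c + F n k + (\<Sum>i\<leftarrow>e. F n (k + i))" for c e
        by (simp add: o_def)
      have split: "sparse n (c @ k # d) \<longleftrightarrow> (sparse n c \<and> ?sum c < F n (k - (n - 1))) \<and>
          (\<exists>e. sparse n e \<and> d = map ((+) k) e)" for c d
        using sparse_split[of n c k d] sparse_snoc_iff[OF n assms(2), of c] sparse_shift[of n k d]
        by argo
      have "?L \<longleftrightarrow> (\<exists>c e. sparse n c \<and> ?sum c < F n (k - (n - 1)) \<and> sparse n e \<and>
          t = ?sum (c @ k # map ((+) k) e))"
        unfolding split by blast
      then show ?thesis unfolding sum .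
    qed
    also have "\<dots> \<longleftrightarrow> (\<exists>c e. sparse n c \<and> ?sum c < F n (k - (n - 1)) \<and> sparse n e \<and>
        t = ?sum c + F n k + ?w (?sum e))"
      using weight_stake_S_inf[OF n assms(3), of _ k] by (simp cong: conj_cong)
    also have "\<dots> \<longleftrightarrow> (\<exists>j m. j < F n (k - (n - 1)) \<and> t = j + F n k + ?w m)"
      (is "?L \<longleftrightarrow> ?R")
    proof
      assume ?R
      then obtain j m where jm: "j < F n (k - (n - 1))" "t = j + F n k + ?w m" by blast
      obtain c e where "sparse n c" "?sum c = j" "sparse n e" "?sum e = m"
        using sparse_exists[OF n] by blast
      with jm show ?L by blast
    qed blast
    finally show ?thesis .
  qed
  have le: "j < F n (k - (n - 1)) \<longleftrightarrow> j \<le> F n (k - (n - 1)) - 1" for j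
    using F_pos[of n "k - (n - 1)"] by linarith
  show ?thesis
    unfolding set_eq_iff mem_Collect_eq iff le weight_def N_def by (simp add: conj_commute)
qed

end
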